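(* In spherical coordinates $(r,\phi,\theta)$ on $\mathbb{R}^3$, let $p^1(r,\phi,\theta)=-r^2$ and $p^2(r,\phi,\theta)=r^2$. Let $g(t)=3t+\frac{3t^2-1}{2}\ln\frac{1-t}{1+t}$ for $t\in(-1,1)$, let $0<t_0<1$ be chosen so that $g'(t_0)=0$, and let $$q(r,\phi,\theta)=-\frac{r^2g(\cos\theta)}{g(t_0)} .$$ Then the function $$u=\begin{cases}p^1 & \text{if } 0\le\theta\le\arccos(t_0)\\ q & \text{if } \arccos(t_0)\le\theta\le\pi-\arccos(t_0)\\ p^2 & \text{if } \pi-\arccos(t_0)\le\theta\le\pi\end{cases}$$ is a double-cone solution to the double obstacle problem with obstacles $p^1,p^2$.
   Context: Spherical coordinates: $x=r\cos\phi\sin\theta$, $y=r\sin\phi\sin\theta$, $z=r\cos\theta$, with $r\ge0$, $0\le\phi<2\pi$, $0\le\theta\le\pi$. A global solution to the (normalised) double obstacle problem in $\mathbb{R}^n$ with obstacles $p^1\le p^2$ is a function $u\in C^{1,1}_{loc}(\mathbb{R}^n)$ with $p^1\le u\le p^2$ and $\Delta u=\lambda_1\chi_{\{u=p^1\}}+\lambda_2\chi_{\{u=p^2\}}$ a.e., where $\lambda_i=\Delta p^i$ (here $\lambda_1=-6$, $\lambda_2=6$). It is a double-cone solution if both $\{u=p^1\}$ and $\{u=p^2\}$ are halfcones with a common vertex (here, circular cones $\{\theta\le\theta_0\}$ and $\{\theta\ge\pi-\theta_0\}$ with vertex at the origin and $0<\theta_0<\pi/2$). *)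

theory Defs
  imports "HOL-Analysis.Analysis"
begin

definition C11_loc :: "('a::euclidean_space \<Rightarrow> real) \<Rightarrow> bool" where
  "C11_loc u \<longleftrightarrow>
     (\<exists>G. (\<forall>x. GDERIV u x :> G x) \<and> (\<forall>K. compact K \<longrightarrow> (\<exists>L. L-lipschitz_on K G)))"

text \<open>
  The pointwise Laplacian, as the trace of the derivative of the gradient. It is a relation, so
  that it also asserts that u is twice differentiable at x. For functions in the class
  \<^const>\<open>C11_loc\<close> this holds almost everywhere (Rademacher), and the value agrees
  almost everywhere with the distributional Laplacian.
\<close>

definition has_laplacian :: "('a::euclidean_space \<Rightarrow> real) \<Rightarrow> real \<Rightarrow> 'a \<Rightarrow> bool" where
  "has_laplacian u l x \<longleftrightarrow>
     (\<exists>G H. (\<forall>\<^sub>F y in nhds x. GDERIV u y :> G y) \<and> (G has_derivative H) (at x) \<and>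
            l = (\<Sum>b\<in>Basis. H b \<bullet> b))"

definition double_obstacle_solution ::
    "('a::euclidean_space \<Rightarrow> real) \<Rightarrow> ('a \<Rightarrow> real) \<Rightarrow> real \<Rightarrow> real \<Rightarrow> ('a \<Rightarrow> real) \<Rightarrow> bool" where
  "double_obstacle_solution p1 p2 l1 l2 u \<longleftrightarrow>
     (\<forall>x. p1 x \<le> p2 x) \<and>
     (\<forall>x. has_laplacian p1 l1 x) \<and> (\<forall>x. has_laplacian p2 l2 x) \<and>
     C11_loc u \<and> (\<forall>x. p1 x \<le> u x \<and> u x \<le> p2 x) \<and>
     (AE x in lebesgue. has_laplacian u
        (l1 * indicator {y. u y = p1 y} x + l2 * indicator {y. u y = p2 y} x) x)"

text \<open>
  The closed circular halfcone with vertex v, unit axis e and half-opening angle a consists of v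
  and of the points x such that the angle between \<open>x - v\<close> and e is at most a.
\<close>

definition halfcone :: "'a::euclidean_space \<Rightarrow> 'a set \<Rightarrow> bool" where
  "halfcone v S \<longleftrightarrow>
     (\<exists>e a. norm e = 1 \<and> 0 < a \<and> a < pi / 2 \<and> S = {x. norm (x - v) * cos a \<le> (x - v) \<bullet> e})"

definition double_cone_solution ::
    "('a::euclidean_space \<Rightarrow> real) \<Rightarrow> ('a \<Rightarrow> real) \<Rightarrow> real \<Rightarrow> real \<Rightarrow> ('a \<Rightarrow> real) \<Rightarrow> bool" where
  "double_cone_solution p1 p2 l1 l2 u \<longleftrightarrow>
     double_obstacle_solution p1 p2 l1 l2 u \<and>
     (\<exists>v. halfcone v {x. u x = p1 x} \<and> halfcone v {x. u x = p2 x})"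

definition spherical :: "real \<Rightarrow> real \<Rightarrow> real \<Rightarrow> real ^ 3" where
  "spherical r \<phi> \<theta> =
     vector [r * cos \<phi> * sin \<theta>, r * sin \<phi> * sin \<theta>, r * cos \<theta>]"

definition spherical_range :: "(real \<times> real \<times> real) set" where
  "spherical_range = {(r, \<phi>, \<theta>). 0 \<le> r \<and> 0 \<le> \<phi> \<and> \<phi> < 2 * pi \<and> 0 \<le> \<theta> \<and> \<theta> \<le> pi}"

end

(* Put h = -g(clamp t)/g(t0), where clamp is the projection onto [-t0, t0]; then u is the zonal
   function |x|^2 h(x.e/|x|) with e the third unit vector. Since g'(t0) = 0 and g is odd, h is C^{1,1}
   on the whole line, and the gradient (2h - t h') x + h' |x| e of u, being homogeneous of degree 1
   with Lipschitz coefficients, is globally Lipschitz. Away from the two cone boundaries, which are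
   null sets, the Laplacian of u is (1 - t^2) h'' - 2 t h' + 6 h. It vanishes between the cones
   because g solves Legendre's equation of degree 2. As g'' < 0 on (0, 1), g is strictly
   increasing on [-t0, t0], so that u touches the obstacles exactly on the cones. *)
theory Submission
  imports Defs
begin

subsection \<open>Zonal functions\<close>

lemma has_laplacian_scaled_norm_squared:
  "has_laplacian (\<lambda>x::'a::euclidean_space. c * (norm x)\<^sup>2) (2 * real DIM('a) * c) x"
  unfolding has_laplacian_def
proof (intro exI conjI)
  show "\<forall>\<^sub>F y in nhds x. GDERIV (\<lambda>x::'a. c * (norm x)\<^sup>2) y :> (2 * c) *\<^sub>R y"
    unfolding gderiv_def power2_norm_eq_inner
    by (intro always_eventually allI) (auto intro!: derivative_eq_intros simp: inner_commute)
  show "((\<lambda>y. (2 * c) *\<^sub>R y) has_derivative (\<lambda>y. (2 * c) *\<^sub>R y)) (at x)"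
    by (auto intro!: derivative_eq_intros)
qed (simp add: inner_Basis)

text \<open>The derivative of \<open>zonal_grad\<close> away from the origin is a multiple of the
  identity plus two maps of rank one. This lemma and the next give its trace without
  coordinates.\<close>

lemma trace_rank_one:
  "(\<Sum>b\<in>Basis. ((b \<bullet> a) *\<^sub>R w) \<bullet> b) = a \<bullet> (w :: 'a::euclidean_space)"
  by (simp add: euclidean_inner[of a w] inner_commute)

lemma trace_scaleR:
  "(\<Sum>b\<in>Basis. (c *\<^sub>R b) \<bullet> (b :: 'a::euclidean_space)) = real DIM('a) * c"
  by (simp add: inner_Basis)

text \<open>At the origin this is 0; everywhere below the value there is multiplied by |x|.\<close>

definition axial :: "'a::euclidean_space \<Rightarrow> 'a \<Rightarrow> real" where
  "axial e x = (x \<bullet> e) / norm x"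

definition zonal :: "(real \<Rightarrow> real) \<Rightarrow> 'a::euclidean_space \<Rightarrow> 'a \<Rightarrow> real" where
  "zonal h e x = (norm x)\<^sup>2 * h (axial e x)"

text \<open>In the gradient of \<open>zonal h e\<close> the factors 1 / |x| cancel. What is left is
  functions of \<open>axial e x\<close> times x and times |x| e. The value at the origin is 0, which
  is the gradient there when \<open>h\<close> is bounded on [-1, 1].\<close>

definition zonal_grad :: "(real \<Rightarrow> real) \<Rightarrow> (real \<Rightarrow> real) \<Rightarrow> 'a::euclidean_space \<Rightarrow> 'a \<Rightarrow> 'a" where
  "zonal_grad h h' e x =
     (2 * h (axial e x) - axial e x * h' (axial e x)) *\<^sub>R x + (h' (axial e x) * norm x) *\<^sub>R e"

section \<open>First and second derivatives of zonal functions\<close>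

lemma axial_bound: "norm e = 1 \<Longrightarrow> axial e x \<in> {-1..1}"
  using Cauchy_Schwarz_ineq2[of x e]
  by (cases "x = 0") (auto simp: axial_def field_simps abs_le_iff)

text \<open>Geometrically, the gradient is the component of \<open>e\<close> orthogonal to x,
  divided by |x|.\<close>

lemma GDERIV_axial:
  assumes "x \<noteq> 0"
  shows "GDERIV (axial e) x :> (1 / norm x) *\<^sub>R e - (axial e x / (norm x)\<^sup>2) *\<^sub>R x"
  unfolding gderiv_def axial_def
  apply (rule derivative_eq_intros has_derivative_norm refl assms | simp add: assms)+
  apply (rule ext)
  using assms
  apply (simp add: inner_diff_right sgn_div_norm field_simps power2_eq_square inner_commute)
  done

lemma GDERIV_zonal:
  assumes "x \<noteq> 0" "(h has_real_derivative h' (axial e x)) (at (axial e x))"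
  shows "GDERIV (zonal h e) x :> zonal_grad h h' e x"
proof -
  have "GDERIV (\<lambda>x. (norm x)\<^sup>2) x :> 2 *\<^sub>R x"
    unfolding gderiv_def power2_norm_eq_inner
    by (auto intro!: derivative_eq_intros simp: inner_commute)
  from GDERIV_mult[OF this GDERIV_DERIV_compose[OF GDERIV_axial[OF assms(1)] assms(2)]]
  have D: "GDERIV (zonal h e) x :> (norm x)\<^sup>2 *\<^sub>R h' (axial e x) *\<^sub>R
     ((1 / norm x) *\<^sub>R e - (axial e x / (norm x)\<^sup>2) *\<^sub>R x) + h (axial e x) *\<^sub>R 2 *\<^sub>R x"
    by (simp add: zonal_def[abs_def])
  show ?thesis
    by (rule GDERIV_subst[OF D])
      (use assms(1) in \<open>simp add: zonal_grad_def algebra_simps power2_eq_square\<close>)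
qed

text \<open>The angular variable has no derivative at the origin, so the chain rule is replaced by
  the estimate |zonal h e y| \<le> M |y|^2, whose right side is o(|y|).\<close>

lemma GDERIV_zonal_0:
  assumes e: "norm e = 1" and bound: "\<And>t. t \<in> {-1..1} \<Longrightarrow> \<bar>h t\<bar> \<le> M"
  shows "GDERIV (zonal h e) 0 :> 0"
  unfolding gderiv_def has_derivative_at_alt
proof (intro conjI allI impI)
  have M: "0 \<le> M" using bound[of 0] by simp
  fix \<epsilon> :: real assume \<epsilon>: "0 < \<epsilon>"
  show "\<exists>d>0. \<forall>y. norm (y - 0) < d \<longrightarrow>
     norm (zonal h e y - zonal h e 0 - (y - 0) \<bullet> 0) \<le> \<epsilon> * norm (y - 0)"
  \<comment> \<open>The summand 1 keeps the radius meaningful when \<open>M\<close> is 0.\<close>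
  proof (intro exI[of _ "\<epsilon> / (M + 1)"] conjI allI impI)
    fix y :: 'a assume y: "norm (y - 0) < \<epsilon> / (M + 1)"
    have "norm y * M \<le> norm y * (M + 1)" by (simp add: algebra_simps)
    also have "\<dots> \<le> \<epsilon>" using y M by (simp add: field_simps)
    finally have "norm y * (norm y * M) \<le> norm y * \<epsilon>" by (intro mult_left_mono) auto
    moreover have "norm y * (norm y * \<bar>h (axial e y)\<bar>) \<le> norm y * (norm y * M)"
      by (intro mult_left_mono bound axial_bound e) auto
    ultimately show "norm (zonal h e y - zonal h e 0 - (y - 0) \<bullet> 0) \<le> \<epsilon> * norm (y - 0)"
      by (simp add: zonal_def abs_mult power2_eq_square mult_ac)
  qed (use \<epsilon> M in auto)
qed auto

text \<open>The weight |y| compensates for the singularity of the angular variable at the origin.\<close>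

lemma axial_diff_bound:
  assumes "norm e = 1"
  shows "\<bar>axial e x - axial e y\<bar> * norm y \<le> 2 * norm (x - y)"
proof (cases "x = 0 \<or> y = 0")
  \<comment> \<open>Since \<open>axial e 0\<close> is 0, the case x = 0 is the Cauchy-Schwarz
    inequality for y and e; for y = 0 the left side vanishes.\<close>
  case True
  then show ?thesis
    using Cauchy_Schwarz_ineq2[of y e] assms norm_ge_zero[of y] by (auto simp: axial_def)
next
  case False
  have "\<bar>axial e x - axial e y\<bar> * norm y = \<bar>(axial e x - axial e y) * norm y\<bar>"
    by (simp add: abs_mult)
  \<comment> \<open>Rescaling x to the length of y turns the difference into one inner product with
    the unit vector \<open>e\<close>. The rescaling moves x by ||y| - |x|| \<le> |x - y|, and the
    remaining distance is |x - y| again, hence the factor 2.\<close>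
  also have "(axial e x - axial e y) * norm y = ((norm y / norm x) *\<^sub>R x - y) \<bullet> e"
    using False by (simp add: axial_def inner_diff_left field_simps)
  also have "\<bar>\<dots>\<bar> \<le> norm ((norm y / norm x) *\<^sub>R x - y)"
    using Cauchy_Schwarz_ineq2[of "(norm y / norm x) *\<^sub>R x - y" e] assms by simp
  also have "(norm y / norm x) *\<^sub>R x - y = (norm y / norm x - 1) *\<^sub>R x + (x - y)"
    by (simp add: algebra_simps)
  also have "norm \<dots> \<le> norm ((norm y / norm x - 1) *\<^sub>R x) + norm (x - y)"
    by (rule norm_triangle_ineq)
  also have "norm ((norm y / norm x - 1) *\<^sub>R x) = \<bar>(norm y / norm x - 1) * norm x\<bar>"
    by (simp add: abs_mult)
  also have "(norm y / norm x - 1) * norm x = norm y - norm x"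
    using False by (simp add: field_simps)
  also have "\<bar>\<dots>\<bar> \<le> norm (x - y)"
    using norm_triangle_ineq3[of y x] by (simp add: norm_minus_commute)
  finally show ?thesis by simp
qed

text \<open>The difference splits into a(s) (V x - V y) and (a(s) - a(t)) V y, where s and t are the
  axial values of x and y. In the first term |a| \<le> |a 0| + L on [-1, 1]; in the second |V y|
  \<le> |y| supplies exactly the weight that \<open>axial_diff_bound\<close> asks for, at cost 2
  L.\<close>

lemma lipschitz_on_axial_scaleR:
  fixes e :: "'a::euclidean_space" and V :: "'a \<Rightarrow> 'a"
  assumes e: "norm e = 1" and a: "L-lipschitz_on {-1..1} a"
    and V: "1-lipschitz_on UNIV V" and V0: "V 0 = 0"
  shows "(2 * L + (\<bar>a 0\<bar> + L))-lipschitz_on UNIV (\<lambda>x. a (axial e x) *\<^sub>R V x)"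
proof (rule lipschitz_onI)
  have L: "0 \<le> L" using a by (rule lipschitz_on_nonneg)
  then show "0 \<le> 2 * L + (\<bar>a 0\<bar> + L)" by simp
  fix x y :: 'a
  let ?s = "axial e x" and ?t = "axial e y"
  have V1: "norm (V x - V y) \<le> norm (x - y)" for x y
    using lipschitz_onD[OF V, of x y] by (simp add: dist_norm)
  have V2: "norm (V y) \<le> norm y"
    using V1[of y 0] V0 by simp
  have st: "?s \<in> {-1..1}" "?t \<in> {-1..1}" using axial_bound[OF e] by auto
  have "\<bar>a ?s - a 0\<bar> \<le> L * \<bar>?s\<bar>"
    using lipschitz_onD[OF a st(1), of 0] by (simp add: dist_real_def)
  also have "\<dots> \<le> L * 1" using st L by (intro mult_left_mono) auto
  finally have as: "\<bar>a ?s\<bar> \<le> \<bar>a 0\<bar> + L" by simp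
  have "\<bar>a ?s - a ?t\<bar> * norm (V y) \<le> (L * \<bar>?s - ?t\<bar>) * norm y"
    using lipschitz_onD[OF a st] V2 L by (intro mult_mono) (auto simp: dist_real_def)
  also have "\<dots> \<le> L * (2 * norm (x - y))"
    unfolding mult.assoc using axial_diff_bound[OF e] L by (intro mult_left_mono)
  finally have 1: "\<bar>a ?s - a ?t\<bar> * norm (V y) \<le> L * (2 * norm (x - y))" .
  have 2: "\<bar>a ?s\<bar> * norm (V x - V y) \<le> (\<bar>a 0\<bar> + L) * norm (x - y)"
    using as V1 L by (intro mult_mono) auto
  have "a ?s *\<^sub>R V x - a ?t *\<^sub>R V y = a ?s *\<^sub>R (V x - V y) + (a ?s - a ?t) *\<^sub>R V y"
    by (simp add: algebra_simps)
  then have "dist (a ?s *\<^sub>R V x) (a ?t *\<^sub>R V y) \<le>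
      \<bar>a ?s\<bar> * norm (V x - V y) + \<bar>a ?s - a ?t\<bar> * norm (V y)"
    by (metis dist_norm norm_scaleR norm_triangle_ineq)
  with 1 2 show "dist (a ?s *\<^sub>R V x) (a ?t *\<^sub>R V y) \<le> (2 * L + (\<bar>a 0\<bar> + L)) * dist x y"
    by (simp add: dist_norm algebra_simps)
qed

lemma lipschitz_on_mult_bounded:
  fixes f g :: "'a::metric_space \<Rightarrow> real"
  assumes f: "C-lipschitz_on X f" and g: "D-lipschitz_on X g"
    and M: "\<And>x. x \<in> X \<Longrightarrow> \<bar>f x\<bar> \<le> M" and N: "\<And>x. x \<in> X \<Longrightarrow> \<bar>g x\<bar> \<le> N"
    and "0 \<le> M" "0 \<le> N"
  shows "(M * D + N * C)-lipschitz_on X (\<lambda>x. f x * g x)"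
proof (rule lipschitz_onI)
  fix x y assume xy: "x \<in> X" "y \<in> X"
  have "\<bar>f x * (g x - g y) + (f x - f y) * g y\<bar> \<le> \<bar>f x\<bar> * \<bar>g x - g y\<bar> + \<bar>f x - f y\<bar> * \<bar>g y\<bar>"
    by (metis abs_mult abs_triangle_ineq)
  also have "\<dots> \<le> M * (D * dist x y) + (C * dist x y) * N"
    using M[OF xy(1)] N[OF xy(2)] \<open>0 \<le> M\<close> lipschitz_onD[OF f xy] lipschitz_onD[OF g xy]
      mult_nonneg_nonneg[OF lipschitz_on_nonneg[OF f] zero_le_dist[of x y]]
    by (intro add_mono mult_mono) (simp_all add: dist_real_def)
  finally show "dist (f x * g x) (f y * g y) \<le> (M * D + N * C) * dist x y"
    by (simp add: dist_real_def algebra_simps)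
next
  show "0 \<le> M * D + N * C"
    using lipschitz_on_nonneg[OF f] lipschitz_on_nonneg[OF g] \<open>0 \<le> M\<close> \<open>0 \<le> N\<close> by simp
qed

text \<open>Both terms of \<open>zonal_grad\<close> are instances of
  \<open>lipschitz_on_axial_scaleR\<close>, with V x = x and V x = |x| e. The resulting constant is
  global and so serves every compact set.\<close>

lemma C11_loc_zonal:
  fixes e :: "'a::euclidean_space"
  assumes e: "norm e = 1" and h: "\<And>t. (h has_real_derivative h' t) (at t)"
    and h': "L-lipschitz_on {-1..1} h'"
  shows "C11_loc (zonal h e)"
proof -
  have L: "0 \<le> L" using h' by (rule lipschitz_on_nonneg)
  define N where "N = \<bar>h' 0\<bar> + L"
  have N: "\<bar>h' t\<bar> \<le> N" if "t \<in> {-1..1}" for t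
  proof -
    have "\<bar>h' t - h' 0\<bar> \<le> L * \<bar>t\<bar>"
      using lipschitz_onD[OF h' that, of 0] by (simp add: dist_real_def)
    also have "\<dots> \<le> L * 1" using that L by (intro mult_left_mono) auto
    finally show ?thesis unfolding N_def by simp
  qed
  have N0: "0 \<le> N" using L by (simp add: N_def)
  have hl: "N-lipschitz_on {-1..1} h"
  proof (rule lipschitz_onI)
    fix x y :: real assume "x \<in> {-1..1}" "y \<in> {-1..1}"
    then show "dist (h x) (h y) \<le> N * dist x y"
      unfolding dist_norm using N DERIV_subset[OF h]
      by (intro field_differentiable_bound[of "{-1..1}"]) simp_all
  qed (rule N0)
  \<comment> \<open>The coefficient of x in the gradient is 2 h - t h'. Its product term is
    Lipschitz because |t| \<le> 1 and |h'| \<le> \<open>N\<close> on [-1, 1].\<close>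
  have "(1 * L + N * 1)-lipschitz_on {-1..1} (\<lambda>t. t * h' t)"
    using N N0 by (intro lipschitz_on_mult_bounded h' lipschitz_on_id) auto
  from lipschitz_on_diff[OF lipschitz_on_cmult_real[OF hl, of 2] this]
  obtain K where K: "K-lipschitz_on {-1..1} (\<lambda>t. 2 * h t - t * h' t)" by blast
  have "1-lipschitz_on UNIV (\<lambda>x::'a. norm x *\<^sub>R e)"
  proof (rule lipschitz_onI)
    show "dist (norm x *\<^sub>R e) (norm y *\<^sub>R e) \<le> 1 * dist x y" for x y :: 'a
      using norm_triangle_ineq3[of x y] e by (simp add: dist_norm flip: scaleR_left_diff_distrib)
  qed simp
  note lip = lipschitz_on_add[OF lipschitz_on_axial_scaleR[OF e K lipschitz_on_id]
      lipschitz_on_axial_scaleR[OF e h' this]]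
  have "\<exists>Q. Q-lipschitz_on UNIV (zonal_grad h h' e)"
    unfolding zonal_grad_def[abs_def] scaleR_scaleR[symmetric] by (intro exI, rule lip) simp_all
  then obtain Q where "Q-lipschitz_on UNIV (zonal_grad h h' e)" ..
  then have lip: "Q-lipschitz_on S (zonal_grad h h' e)" for S
    by (rule lipschitz_on_subset) simp
  have "GDERIV (zonal h e) x :> zonal_grad h h' e x" for x
  proof (cases "x = 0")
    case True
    have "compact (h ` {-1..1})"
      by (intro compact_continuous_image lipschitz_on_continuous_on[OF hl] compact_Icc)
    then obtain M where "\<forall>s\<in>h ` {-1..1}. norm s \<le> M"
      using compact_imp_bounded bounded_iff by metis
    then have "GDERIV (zonal h e) 0 :> 0"
      by (intro GDERIV_zonal_0[OF e, of _ M]) auto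
    then show ?thesis by (simp add: True zonal_grad_def)
  qed (intro GDERIV_zonal h)
  with lip show ?thesis unfolding C11_loc_def by blast
qed

text \<open>The trace of the derivative of \<open>zonal_grad\<close> has three contributions: (1 -
  t^2) h'' from the dependence on t, the dimension times 2 h - t h' from the factor x, and t h' from
  the factor |x|. The second derivative is required only at the point \<open>axial e x\<close>,
  which suits a profile whose h' has corners elsewhere.\<close>

lemma has_laplacian_zonal:
  fixes e :: "'a::euclidean_space"
  assumes e: "norm e = 1" and x: "x \<noteq> 0" and h: "\<And>t. (h has_real_derivative h' t) (at t)"
    and h': "(h' has_real_derivative h'') (at (axial e x))"
    and l: "l = (1 - (axial e x)\<^sup>2) * h'' - (real DIM('a) - 1) * axial e x * h' (axial e x)
              + 2 * real DIM('a) * h (axial e x)"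
  shows "has_laplacian (zonal h e) l x"
  unfolding has_laplacian_def
proof (intro exI conjI)
  let ?t = "axial e x"
  define a where "a = (1 / norm x) *\<^sub>R e - (?t / (norm x)\<^sup>2) *\<^sub>R x"
  let ?A = "2 * h ?t - ?t * h' ?t"
  \<comment> \<open>\<open>?w\<close> is the derivative of \<open>zonal_grad\<close> with respect to
    t while x and |x| are held fixed; \<open>a\<close> is the gradient of t.\<close>
  let ?w = "(h' ?t - ?t * h'') *\<^sub>R x + (h'' * norm x) *\<^sub>R e"
  let ?H = "\<lambda>v. (v \<bullet> a) *\<^sub>R ?w + ?A *\<^sub>R v + (v \<bullet> (h' ?t *\<^sub>R sgn x)) *\<^sub>R e"
  have "\<forall>\<^sub>F y in nhds x. y \<noteq> 0"
    using x by (rule t1_space_nhds)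
  then show "\<forall>\<^sub>F y in nhds x. GDERIV (zonal h e) y :> zonal_grad h h' e y"
    by eventually_elim (intro GDERIV_zonal h)
  have ax: "GDERIV (axial e) x :> a"
    unfolding a_def by (rule GDERIV_axial[OF x])
  have ax_h: "((\<lambda>y. h (axial e y)) has_derivative (\<lambda>v. h' ?t * (v \<bullet> a))) (at x)"
    using GDERIV_DERIV_compose[OF ax h] by (simp add: gderiv_def)
  have ax_h': "((\<lambda>y. h' (axial e y)) has_derivative (\<lambda>v. h'' * (v \<bullet> a))) (at x)"
    using GDERIV_DERIV_compose[OF ax h'] by (simp add: gderiv_def)
  note ax = ax[unfolded gderiv_def]
  have 1: "((\<lambda>y. 2 * h (axial e y) - axial e y * h' (axial e y)) has_derivative
      (\<lambda>v. 2 * (h' ?t * (v \<bullet> a)) - (?t * (h'' * (v \<bullet> a)) + (v \<bullet> a) * h' ?t))) (at x)"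
    by (intro has_derivative_diff has_derivative_mult has_derivative_mult_right ax ax_h ax_h')
  have 2: "((\<lambda>y. h' (axial e y) * norm y) has_derivative
      (\<lambda>v. h' ?t * (v \<bullet> sgn x) + h'' * (v \<bullet> a) * norm x)) (at x)"
    by (intro has_derivative_mult has_derivative_norm ax_h' x)
  show "(zonal_grad h h' e has_derivative ?H) (at x)"
    unfolding zonal_grad_def[abs_def]
    by (rule has_derivative_eq_rhs[OF has_derivative_add[OF
          has_derivative_scaleR[OF 1 has_derivative_ident]
          has_derivative_scaleR[OF 2 has_derivative_const]]])
      (simp add: fun_eq_iff algebra_simps)
  have t: "x \<bullet> e = ?t * norm x" using x by (simp add: axial_def)
  have ee: "e \<bullet> e = 1" using e by (simp add: norm_eq_1)
  have xx: "x \<bullet> x = norm x * norm x" by (simp add: power2_norm_eq_inner flip: power2_eq_square)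
  \<comment> \<open>The function \<open>axial e\<close> is constant along rays from the origin, so
    its gradient is orthogonal to x. In the trace this removes the part of \<open>?w\<close> along
    x.\<close>
  have ax: "a \<bullet> x = 0" and ae: "a \<bullet> e = (1 - ?t\<^sup>2) / norm x"
    using x by (simp_all add: a_def inner_diff_left inner_commute[of e x] t ee xx field_simps
        power2_eq_square)
  have "(\<Sum>b\<in>Basis. ?H b \<bullet> b) = a \<bullet> ?w + DIM('a) * ?A + (h' ?t *\<^sub>R sgn x) \<bullet> e"
    by (simp only: inner_add_left[of "_ + _"] inner_add_left[of "(_ \<bullet> _) *\<^sub>R _"] sum.distrib
        trace_rank_one trace_scaleR)
  also have "\<dots> = l"
    using x by (simp add: l inner_add_right ax ae t sgn_div_norm) (simp add: field_simps)
  finally show "l = (\<Sum>b\<in>Basis. ?H b \<bullet> b)" ..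
qed

text \<open>The function x \<bullet> e - s |x| is concave and takes the positive value 1 - s at
  \<open>e\<close>. Hence it is positive on the segment from \<open>e\<close> to any of its zeros,
  apart from that zero itself, and each ray from \<open>e\<close> meets the closed zero set at most
  once.\<close>

lemma negligible_cone_boundary:
  fixes e :: "'a::euclidean_space"
  assumes e: "norm e = 1" and s0: "0 \<le> s" and s: "s < 1"
  shows "negligible {x. x \<bullet> e = s * norm x}"
proof (rule starlike_negligible_strong[where a = e])
  show "closed {x. x \<bullet> e = s * norm x}"
    by (intro closed_Collect_eq continuous_intros)
  fix c :: real and x :: 'a
  assume c: "0 \<le> c" "c < 1" and "e + x \<in> {x. x \<bullet> e = s * norm x}"
  then have ex: "s * norm (e + x) = (e + x) \<bullet> e" by simp
  have eq: "e + c *\<^sub>R x = (1 - c) *\<^sub>R e + c *\<^sub>R (e + x)" by (simp add: algebra_simps)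
  have "norm (e + c *\<^sub>R x) \<le> (1 - c) + c * norm (e + x)"
    unfolding eq using norm_triangle_ineq[of "(1 - c) *\<^sub>R e" "c *\<^sub>R (e + x)"] e c by simp
  then have "s * norm (e + c *\<^sub>R x) \<le> s * ((1 - c) + c * norm (e + x))"
    using s0 by (rule mult_left_mono)
  also have "\<dots> = s * (1 - c) + c * (s * norm (e + x))" by (simp add: algebra_simps)
  also have "\<dots> < 1 * (1 - c) + c * (s * norm (e + x))"
    using s c by (intro add_strict_right_mono mult_strict_right_mono) auto
  also have "\<dots> = (e + c *\<^sub>R x) \<bullet> e"
    unfolding ex eq using e by (simp add: inner_add_left norm_eq_1 algebra_simps)
  finally show "e + c *\<^sub>R x \<notin> {x. x \<bullet> e = s * norm x}" by simp
qed
subsection \<open>The profile\<close>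

text \<open>The profile is \<open>-2 Q\<^sub>2\<close>, where \<open>Q\<^sub>2\<close> is the Legendre function of the second kind.\<close>

definition leg :: "real \<Rightarrow> real" where
  "leg t = 3 * t + (3 * t\<^sup>2 - 1) / 2 * ln ((1 - t) / (1 + t))"

definition leg_deriv :: "real \<Rightarrow> real" where
  "leg_deriv t = 3 * t * ln ((1 - t) / (1 + t)) + (4 - 6 * t\<^sup>2) / (1 - t\<^sup>2)"

definition leg_deriv2 :: "real \<Rightarrow> real" where
  "leg_deriv2 t = 3 * ln ((1 - t) / (1 + t)) - 6 * t / (1 - t\<^sup>2) - 4 * t / (1 - t\<^sup>2)\<^sup>2"

section \<open>Derivatives of the profile and Legendre's equation\<close>

lemma one_minus_square_pos: "0 < 1 - t\<^sup>2" if "\<bar>t\<bar> < 1" for t :: real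
  using that by (simp add: abs_square_less_1)

lemma DERIV_ln_ratio:
  assumes "\<bar>t\<bar> < 1"
  shows "((\<lambda>t. ln ((1 - t) / (1 + t))) has_real_derivative - 2 / (1 - t\<^sup>2)) (at t)"
proof -
  have "((\<lambda>t. ln ((1 - t) / (1 + t))) has_real_derivative
      inverse ((1 - t) / (1 + t)) * (((0 - 1) * (1 + t) - (1 - t) * (0 + 1)) / ((1 + t) * (1 + t)))) (at t)"
    using assms
    by (intro DERIV_ln[THEN DERIV_chain2] DERIV_divide DERIV_diff DERIV_add DERIV_const DERIV_ident) auto
  moreover have "inverse ((1 - t) / (1 + t)) *
      (((0 - 1) * (1 + t) - (1 - t) * (0 + 1)) / ((1 + t) * (1 + t))) = - 2 / ((1 - t) * (1 + t))"
  proof -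
    have "1 - t \<noteq> 0" "1 + t \<noteq> 0" using assms by auto
    then show ?thesis by (simp add: divide_simps)
  qed
  moreover have "(1 - t) * (1 + t) = 1 - t\<^sup>2" by (simp add: algebra_simps power2_eq_square)
  ultimately show ?thesis by simp
qed

lemma DERIV_leg: "(leg has_real_derivative leg_deriv t) (at t)" if "\<bar>t\<bar> < 1"
proof -
  \<comment> \<open>With the logarithm kept opaque, the remaining identity is rational in t and
    \<open>L t\<close>.\<close>
  define L :: "real \<Rightarrow> real" where "L = (\<lambda>t. ln ((1 - t) / (1 + t)))"
  have leg: "leg = (\<lambda>t. 3 * t + (3 * t\<^sup>2 - 1) / 2 * L t)"
    by (simp add: leg_def[abs_def] L_def)
  have L: "(L has_real_derivative - 2 / (1 - t\<^sup>2)) (at t)"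
    unfolding L_def by (rule DERIV_ln_ratio[OF that])
  have "(leg has_real_derivative 3 + (3 * t * L t + (3 * t\<^sup>2 - 1) / 2 * (- 2 / (1 - t\<^sup>2)))) (at t)"
    unfolding leg by (rule derivative_eq_intros L refl | simp)+
  moreover have "1 - t\<^sup>2 \<noteq> 0" using one_minus_square_pos[OF that] by simp
  then have "3 + (3 * t * L t + (3 * t\<^sup>2 - 1) / 2 * (- 2 / (1 - t\<^sup>2))) = leg_deriv t"
    by (simp add: leg_deriv_def L_def[symmetric] field_simps) (simp add: L_def)
  ultimately show ?thesis by simp
qed

lemma DERIV_leg_deriv: "(leg_deriv has_real_derivative leg_deriv2 t) (at t)" if "\<bar>t\<bar> < 1"
proof -
  define L :: "real \<Rightarrow> real" where "L = (\<lambda>t. ln ((1 - t) / (1 + t)))"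
  have leg: "leg_deriv = (\<lambda>t. 3 * t * L t + (4 - 6 * t\<^sup>2) / (1 - t\<^sup>2))"
    by (simp add: leg_deriv_def[abs_def] L_def)
  have L: "(L has_real_derivative - 2 / (1 - t\<^sup>2)) (at t)"
    unfolding L_def by (rule DERIV_ln_ratio[OF that])
  define w where "w = 1 - t\<^sup>2"
  have w: "w \<noteq> 0" using one_minus_square_pos[OF that] by (simp add: w_def)
  have "(leg_deriv has_real_derivative (3 * L t + 3 * t * (- 2 / (1 - t\<^sup>2))) +
      (- 12 * t * (1 - t\<^sup>2) - (4 - 6 * t\<^sup>2) * (- 2 * t)) / ((1 - t\<^sup>2) * (1 - t\<^sup>2))) (at t)"
    unfolding leg by (rule derivative_eq_intros L refl | use w in \<open>simp add: w_def\<close>)+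
  also have "(3 * L t + 3 * t * (- 2 / (1 - t\<^sup>2))) +
      (- 12 * t * (1 - t\<^sup>2) - (4 - 6 * t\<^sup>2) * (- 2 * t)) / ((1 - t\<^sup>2) * (1 - t\<^sup>2)) = leg_deriv2 t"
  proof -
    have "- 12 * t * (1 - t\<^sup>2) - (4 - 6 * t\<^sup>2) * (- 2 * t) = - 4 * t"
      by (simp add: algebra_simps)
    then show ?thesis
      by (simp add: leg_deriv2_def L_def power2_eq_square[of "1 - t\<^sup>2"])
  qed
  finally show ?thesis .
qed

text \<open>The coefficient of the logarithm is 3 (1 - t^2) - 6 t^2 + 3 (3 t^2 - 1) = 0. The
  rational terms cancel once (4 - 6 t^2) / (1 - t^2) is written as 6 - 2 / (1 - t^2). In dimension 3
  this equation says that |x|^2 times \<open>leg\<close> of the axial variable is harmonic.\<close>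

lemma legendre_equation:
  assumes "\<bar>t\<bar> < 1"
  shows "(1 - t\<^sup>2) * leg_deriv2 t - 2 * t * leg_deriv t + 6 * leg t = 0"
proof -
  have "1 - t\<^sup>2 \<noteq> 0" using one_minus_square_pos[OF assms] by simp
  have "w * (A - B / w - C / w\<^sup>2) = w * A - B - C / w" if "w \<noteq> 0" for A B C w :: real
    using that by (simp add: field_simps power2_eq_square)
  from this[OF \<open>1 - t\<^sup>2 \<noteq> 0\<close>]
  have 1: "(1 - t\<^sup>2) * leg_deriv2 t =
      (1 - t\<^sup>2) * (3 * ln ((1 - t) / (1 + t))) - 6 * t - 4 * t / (1 - t\<^sup>2)"
    unfolding leg_deriv2_def .
  have 2: "(4 - 6 * t\<^sup>2) / (1 - t\<^sup>2) = 6 - 2 / (1 - t\<^sup>2)"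
    using \<open>1 - t\<^sup>2 \<noteq> 0\<close> by (simp add: field_simps)
  show ?thesis
    unfolding 1 leg_deriv_def 2 leg_def by (simp add: field_simps power2_eq_square)
qed

section \<open>Parity, monotonicity and Lipschitz bounds of the profile\<close>

lemma ln_ratio_minus: "ln ((1 + t) / (1 - t)) = - ln ((1 - t) / (1 + t))" if "\<bar>t\<bar> < 1" for t :: real
  using that by (simp add: ln_div)

lemma leg_minus: "leg (- t) = - leg t" and leg_deriv_minus: "leg_deriv (- t) = leg_deriv t"
  if "\<bar>t\<bar> < 1"
  using that by (simp_all add: leg_def leg_deriv_def ln_ratio_minus)

text \<open>Each of the three terms of \<open>leg_deriv2\<close> is negative on (0, 1).\<close>

lemma leg_deriv2_neg: "leg_deriv2 t < 0" if "0 < t" "t < 1"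
proof -
  have "ln ((1 - t) / (1 + t)) < 0" using that by (subst ln_less_zero_iff) auto
  moreover have "0 < 1 - t\<^sup>2" using that by (intro one_minus_square_pos) auto
  then have "0 < 6 * t / (1 - t\<^sup>2)" "0 < 4 * t / (1 - t\<^sup>2)\<^sup>2" using that by simp_all
  ultimately show ?thesis unfolding leg_deriv2_def by linarith
qed

text \<open>The derivative is even, so t may be replaced by |t|; on [0, s] it decreases strictly to
  its zero at s. Since \<open>leg_deriv2\<close> vanishes at 0, its sign is used only in the open
  interval between |t| and s.\<close>

lemma leg_deriv_pos:
  assumes s: "0 < s" "s < 1" "leg_deriv s = 0" and t: "\<bar>t\<bar> < s"
  shows "0 < leg_deriv t"
proof -
  have "leg_deriv s < leg_deriv \<bar>t\<bar>"
  proof (rule DERIV_neg_imp_decreasing_open[OF t])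
    show "\<exists>y. DERIV leg_deriv x :> y \<and> y < 0" if "\<bar>t\<bar> < x" "x < s" for x
      using that s by (intro exI[of _ "leg_deriv2 x"] conjI DERIV_leg_deriv leg_deriv2_neg) auto
    show "continuous_on {\<bar>t\<bar>..s} leg_deriv"
      using s by (intro continuous_at_imp_continuous_on ballI DERIV_isCont[OF DERIV_leg_deriv]) auto
  qed
  moreover have "leg_deriv \<bar>t\<bar> = leg_deriv t"
    using t s leg_deriv_minus[of t] by (simp add: abs_if)
  ultimately show ?thesis using s by simp
qed

text \<open>Strictness extends to the endpoints, although \<open>leg_deriv\<close> vanishes at s and
  - s, because positivity is used only between x and y. This is what later determines the contact
  sets exactly.\<close>

lemma leg_strict_mono:
  assumes s: "0 < s" "s < 1" "leg_deriv s = 0" and xy: "- s \<le> x" "x < y" "y \<le> s"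
  shows "leg x < leg y"
proof (rule DERIV_pos_imp_increasing_open[OF xy(2)])
  show "\<exists>d. DERIV leg z :> d \<and> d > 0" if "x < z" "z < y" for z
    using that s xy by (intro exI[of _ "leg_deriv z"] conjI DERIV_leg leg_deriv_pos[of s]) auto
  show "continuous_on {x..y} leg"
    using s xy by (intro continuous_at_imp_continuous_on ballI DERIV_isCont[OF DERIV_leg]) auto
qed

lemma leg_zero: "leg 0 = 0"
  by (simp add: leg_def)

text \<open>As s < 1, the compact interval avoids the singularities at 1 and - 1, so
  \<open>leg_deriv2\<close> is continuous and bounded on it.\<close>

lemma lipschitz_on_leg_deriv:
  assumes "s < 1"
  obtains L where "L-lipschitz_on {-s..s} leg_deriv"
proof (cases "0 \<le> s")
  case True
  have "1 - t\<^sup>2 \<noteq> 0" if "t \<in> {-s..s}" for t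
  proof -
    have "\<bar>t\<bar> < 1" using that assms by (simp add: abs_if)
    then show ?thesis using one_minus_square_pos[of t] by simp
  qed
  then have "continuous_on {-s..s} leg_deriv2"
    unfolding leg_deriv2_def[abs_def] using assms
    by (intro continuous_intros) (auto simp: field_simps)
  then have "compact (leg_deriv2 ` {-s..s})"
    by (intro compact_continuous_image compact_Icc)
  then obtain L where L: "\<forall>d\<in>leg_deriv2 ` {-s..s}. norm d \<le> L"
    using compact_imp_bounded bounded_iff by metis
  have "L-lipschitz_on {-s..s} leg_deriv"
  proof (rule lipschitz_onI)
    show "dist (leg_deriv x) (leg_deriv y) \<le> L * dist x y" if "x \<in> {-s..s}" "y \<in> {-s..s}" for x y
      unfolding dist_norm using that L assms
      by (intro field_differentiable_bound[of "{-s..s}" _ leg_deriv2]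
          has_field_derivative_at_within[OF DERIV_leg_deriv]) auto
    have "norm (leg_deriv2 0) \<le> L" using L True by auto
    then show "0 \<le> L" using norm_ge_zero order_trans by blast
  qed
  then show ?thesis by (rule that)
next
  case False
  then have "{-s..s} = {}" by simp
  then show ?thesis using that[of 0] by (simp only: lipschitz_on_empty)
qed

section \<open>Truncation to a symmetric interval\<close>

definition clamp_sym :: "real \<Rightarrow> real \<Rightarrow> real" where
  "clamp_sym s t = max (- s) (min s t)"

lemma clamp_sym_dist: "\<bar>clamp_sym s x - clamp_sym s y\<bar> \<le> \<bar>x - y\<bar>"
  by (auto simp: clamp_sym_def max_def min_def)

lemma clamp_sym_bound: "0 \<le> s \<Longrightarrow> clamp_sym s t \<in> {-s..s}"
  by (auto simp: clamp_sym_def)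

text \<open>The inner function may have a corner at c, as \<open>clamp_sym\<close> has at s and - s.
  A vanishing derivative means f y - f c = o(|y - c|), and an inner function that fixes c and brings
  no point farther from c preserves this estimate.\<close>

lemma DERIV_zero_compose_nonexpansive:
  fixes f k :: "real \<Rightarrow> real"
  assumes "(f has_real_derivative 0) (at c)" "k c = c" "\<And>x. \<bar>k x - c\<bar> \<le> \<bar>x - c\<bar>"
  shows "((\<lambda>x. f (k x)) has_real_derivative 0) (at c)"
proof -
  have f: "\<forall>\<epsilon>>0. \<exists>d>0. \<forall>y. \<bar>y - c\<bar> < d \<longrightarrow> \<bar>f y - f c\<bar> \<le> \<epsilon> * \<bar>y - c\<bar>"
    using assms(1) by (simp add: has_field_derivative_def has_derivative_at_alt)
  have "\<forall>\<epsilon>>0. \<exists>d>0. \<forall>y. \<bar>y - c\<bar> < d \<longrightarrow> \<bar>f (k y) - f c\<bar> \<le> \<epsilon> * \<bar>y - c\<bar>"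
  proof (intro allI impI)
    fix \<epsilon> :: real assume "0 < \<epsilon>"
    with f obtain d where "0 < d"
      and d: "\<And>y. \<bar>y - c\<bar> < d \<Longrightarrow> \<bar>f y - f c\<bar> \<le> \<epsilon> * \<bar>y - c\<bar>" by blast
    have "\<bar>f (k y) - f c\<bar> \<le> \<epsilon> * \<bar>y - c\<bar>" if "\<bar>y - c\<bar> < d" for y
    proof -
      have "\<bar>f (k y) - f c\<bar> \<le> \<epsilon> * \<bar>k y - c\<bar>"
        using assms(3)[of y] that by (intro d) simp
      also have "\<dots> \<le> \<epsilon> * \<bar>y - c\<bar>"
        using assms(3)[of y] \<open>0 < \<epsilon>\<close> by (intro mult_left_mono) simp_all
      finally show ?thesis .
    qed
    with \<open>0 < d\<close> show "\<exists>d>0. \<forall>y. \<bar>y - c\<bar> < d \<longrightarrow> \<bar>f (k y) - f c\<bar> \<le> \<epsilon> * \<bar>y - c\<bar>"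
      by blast
  qed
  then show ?thesis
    using assms(2) by (simp add: has_field_derivative_def has_derivative_at_alt bounded_linear_mult_right)
qed

text \<open>Inside the interval the truncation is locally the identity, and outside it is locally
  constant. At the two joints the vanishing derivative of \<open>f\<close> makes the pieces
  fit.\<close>

lemma DERIV_clamp_sym:
  assumes s: "0 < s" and f: "\<And>t. t \<in> {-s..s} \<Longrightarrow> (f has_real_derivative f' t) (at t)"
    and 0: "f' s = 0" "f' (- s) = 0"
  shows "((\<lambda>t. f (clamp_sym s t)) has_real_derivative f' (clamp_sym s t)) (at t)"
proof -
  have const: "((\<lambda>t. f (clamp_sym s t)) has_real_derivative 0) (at t)"
    if "open S" "t \<in> S" "\<And>y. y \<in> S \<Longrightarrow> clamp_sym s y = c" for S c
    by (rule has_field_derivative_transform_within_open[OF DERIV_const[of "f c"] that(1,2)])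
      (simp add: that(3))
  have joint: "((\<lambda>t. f (clamp_sym s t)) has_real_derivative 0) (at c)"
    if "c \<in> {-s..s}" "f' c = 0" for c
  proof (rule DERIV_zero_compose_nonexpansive[where f = f and k = "clamp_sym s"])
    show "(f has_real_derivative 0) (at c)" using f[OF that(1)] that(2) by simp
    show c: "clamp_sym s c = c" using that by (simp add: clamp_sym_def)
    show "\<bar>clamp_sym s x - c\<bar> \<le> \<bar>x - c\<bar>" for x
      using clamp_sym_dist[of s x c] c by simp
  qed
  consider "- s < t" "t < s" | "t = s" | "t = - s" | "t > s" | "t < - s" by linarith
  then show ?thesis
  proof cases
    case 1
    then have t: "clamp_sym s t = t" by (simp add: clamp_sym_def)
    have ft: "(f has_real_derivative f' t) (at t)" using 1 by (intro f) simp
    show ?thesis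
      unfolding t
      by (rule has_field_derivative_transform_within_open[OF ft, of "{-s<..<s}"])
        (use 1 in \<open>simp_all add: clamp_sym_def\<close>)
  next
    case 2
    then show ?thesis using joint[of s] s 0 by (simp add: clamp_sym_def)
  next
    case 3
    then show ?thesis using joint[of "- s"] s 0 by (simp add: clamp_sym_def)
  next
    case 4
    then show ?thesis using const[of "{s<..}" s] s 0 by (simp add: clamp_sym_def)
  next
    case 5
    then show ?thesis using const[of "{..<-s}" "- s"] s 0 by (simp add: clamp_sym_def)
  qed
qed

subsection \<open>Spherical coordinates\<close>

lemma inner_axis3_spherical: "spherical r \<phi> \<theta> \<bullet> axis 3 1 = r * cos \<theta>"
  by (simp add: spherical_def inner_axis)

lemma norm_spherical: "0 \<le> r \<Longrightarrow> norm (spherical r \<phi> \<theta>) = r"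
proof -
  assume r: "0 \<le> r"
  have "(r * cos \<phi> * sin \<theta>)\<^sup>2 + (r * sin \<phi> * sin \<theta>)\<^sup>2 + (r * cos \<theta>)\<^sup>2
      = r\<^sup>2 * ((sin \<theta>)\<^sup>2 * ((sin \<phi>)\<^sup>2 + (cos \<phi>)\<^sup>2) + (cos \<theta>)\<^sup>2)"
    by (simp only: power_mult_distrib) algebra
  also have "\<dots> = r\<^sup>2" by (simp only: sin_cos_squared_add mult_1_right)
  finally show ?thesis
    using r by (simp add: norm_vec_def L2_set_def spherical_def sum_3)
qed

text \<open>This makes data prescribed in spherical coordinates determine a function on the whole
  space.\<close>

lemma spherical_surj:
  fixes x :: "real ^ 3"
  obtains r \<phi> \<theta> where "(r, \<phi>, \<theta>) \<in> spherical_range" "x = spherical r \<phi> \<theta>"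
proof (cases "x = 0")
  case True
  have "(0, 0, 0) \<in> spherical_range" by (simp add: spherical_range_def)
  moreover have "x = spherical 0 0 0"
    using True by (simp add: spherical_def vec_eq_iff forall_3)
  ultimately show ?thesis by (rule that)
next
  case False
  define r where "r = norm x"
  have r: "0 < r" using False by (simp add: r_def)
  have r2: "r\<^sup>2 = (x$1)\<^sup>2 + (x$2)\<^sup>2 + (x$3)\<^sup>2"
    by (simp add: r_def norm_vec_def L2_set_def sum_3)
  have z: "\<bar>x$3\<bar> \<le> r" unfolding r_def by (rule component_le_norm_cart)
  define \<theta> where "\<theta> = arccos (x$3 / r)"
  have zr: "- 1 \<le> x$3 / r" "x$3 / r \<le> 1" using z r by (auto simp: field_simps)
  have \<theta>: "0 \<le> \<theta>" "\<theta> \<le> pi" unfolding \<theta>_def using zr by (auto intro: arccos_lbound arccos_ubound)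
  have x3: "x$3 = r * cos \<theta>" using r zr by (simp add: \<theta>_def cos_arccos)
  \<comment> \<open>\<open>\<rho>\<close> is the distance from the polar axis. On the axis the
    azimuth is arbitrary and is taken to be 0.\<close>
  define \<rho> where "\<rho> = r * sin \<theta>"
  have "\<rho>\<^sup>2 = r\<^sup>2 - (x$3)\<^sup>2"
    unfolding \<rho>_def x3 by (simp add: sin_squared_eq algebra_simps power_mult_distrib)
  then have \<rho>2: "\<rho>\<^sup>2 = (x$1)\<^sup>2 + (x$2)\<^sup>2"
    unfolding r2 by simp
  obtain \<phi> where \<phi>: "0 \<le> \<phi>" "\<phi> < 2 * pi" "x$1 = \<rho> * cos \<phi>" "x$2 = \<rho> * sin \<phi>"
  proof (cases "\<rho> = 0")
    case True
    then show ?thesis using \<rho>2 that[of 0] by (simp add: sum_power2_eq_zero_iff)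
  next
    case False
    then have "(x$1 / \<rho>)\<^sup>2 + (x$2 / \<rho>)\<^sup>2 = 1"
      unfolding power_divide add_divide_distrib[symmetric] \<rho>2[symmetric] by simp
    then obtain \<phi> where "0 \<le> \<phi>" "\<phi> < 2 * pi" "x$1 / \<rho> = cos \<phi>" "x$2 / \<rho> = sin \<phi>"
      by (rule sincos_total_2pi)
    with False show ?thesis by (intro that[of \<phi>]) (auto simp: field_simps)
  qed
  show ?thesis
  proof (rule that)
    show "(r, \<phi>, \<theta>) \<in> spherical_range" using r \<phi> \<theta> by (simp add: spherical_range_def)
    show "x = spherical r \<phi> \<theta>"
      using \<phi> x3 by (simp add: spherical_def vec_eq_iff forall_3 \<rho>_def)
  qed
qed

section \<open>Circular cones in spherical coordinates\<close>

lemma le_arccos_iff: "\<theta> \<le> arccos c \<longleftrightarrow> c \<le> cos \<theta>"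
  if "0 \<le> \<theta>" "\<theta> \<le> pi" "- 1 \<le> c" "c \<le> 1"
  using that
  by (metis arccos_cos arccos_lbound arccos_le_mono arccos_ubound cos_arccos cos_ge_minus_one
      cos_le_one cos_mono_le_eq)

lemma circular_cone_spherical:
  assumes "- 1 \<le> c" "c \<le> 1"
  shows "{x. norm x * c \<le> x \<bullet> axis 3 1} =
    {spherical r \<phi> \<theta> | r \<phi> \<theta>. (r, \<phi>, \<theta>) \<in> spherical_range \<and> \<theta> \<le> arccos c}"
proof (intro set_eqI iffI)
  fix x :: "real ^ 3"
  obtain r \<phi> \<theta> where x: "(r, \<phi>, \<theta>) \<in> spherical_range" "x = spherical r \<phi> \<theta>"
    by (rule spherical_surj)
  assume *: "x \<in> {x. norm x * c \<le> x \<bullet> axis 3 1}"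
  show "x \<in> {spherical r \<phi> \<theta> | r \<phi> \<theta>. (r, \<phi>, \<theta>) \<in> spherical_range \<and> \<theta> \<le> arccos c}"
  proof (cases "r = 0")
    \<comment> \<open>The polar angle of the origin is arbitrary, and the one obtained above may
      exceed \<open>arccos c\<close>; it is replaced by 0.\<close>
    case True
    have "x = spherical 0 0 0" using x True by (simp add: spherical_def)
    moreover have "(0, 0, 0) \<in> spherical_range" by (simp add: spherical_range_def)
    moreover have "0 \<le> arccos c" using assms by (intro arccos_lbound) auto
    ultimately show ?thesis by blast
  next
    case False
    then have "c \<le> cos \<theta>"
      using * x by (simp add: spherical_range_def norm_spherical inner_axis3_spherical)
    then show ?thesis
      using x assms le_arccos_iff[of \<theta> c] unfolding spherical_range_def by blast
  qed
next
  fix x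
  assume "x \<in> {spherical r \<phi> \<theta> | r \<phi> \<theta>. (r, \<phi>, \<theta>) \<in> spherical_range \<and> \<theta> \<le> arccos c}"
  then show "x \<in> {x. norm x * c \<le> x \<bullet> axis 3 1}"
    using assms le_arccos_iff[of _ c]
    by (auto simp: spherical_range_def norm_spherical inner_axis3_spherical intro!: mult_left_mono)
qed

lemma opposite_circular_cone_spherical:
  assumes "- 1 \<le> c" "c \<le> 1"
  shows "{x. norm x * c \<le> x \<bullet> - axis 3 1} =
    {spherical r \<phi> \<theta> | r \<phi> \<theta>. (r, \<phi>, \<theta>) \<in> spherical_range \<and> pi - arccos c \<le> \<theta>}"
proof (intro set_eqI iffI)
  \<comment> \<open>The reflection of \<theta> to pi - \<theta> exchanges the two cones.\<close>
  have iff: "pi - arccos c \<le> \<theta> \<longleftrightarrow> c \<le> - cos \<theta>" if "0 \<le> \<theta>" "\<theta> \<le> pi" for \<theta>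
    using le_arccos_iff[of "pi - \<theta>" c] that assms by auto
  fix x :: "real ^ 3"
  {
    obtain r \<phi> \<theta> where x: "(r, \<phi>, \<theta>) \<in> spherical_range" "x = spherical r \<phi> \<theta>"
      by (rule spherical_surj)
    assume *: "x \<in> {x. norm x * c \<le> x \<bullet> - axis 3 1}"
    show "x \<in> {spherical r \<phi> \<theta> | r \<phi> \<theta>. (r, \<phi>, \<theta>) \<in> spherical_range \<and> pi - arccos c \<le> \<theta>}"
    proof (cases "r = 0")
      \<comment> \<open>Here the origin is given the polar angle pi, which always satisfies the
        bound.\<close>
      case True
      have "x = spherical 0 0 pi" using x True by (simp add: spherical_def)
      moreover have "(0, 0, pi) \<in> spherical_range" by (simp add: spherical_range_def)
      moreover have "pi - arccos c \<le> pi" using assms arccos_lbound[of c] by auto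
      ultimately show ?thesis by blast
    next
      case False
      then have "r * c \<le> r * (- cos \<theta>)" "0 < r"
        using * x by (simp_all add: spherical_range_def norm_spherical inner_axis3_spherical)
      then have "c \<le> - cos \<theta>" by (simp only: mult_le_cancel_left_pos)
      then show ?thesis
        using x assms iff[of \<theta>] unfolding spherical_range_def by blast
    qed
  next
    assume "x \<in> {spherical r \<phi> \<theta> | r \<phi> \<theta>. (r, \<phi>, \<theta>) \<in> spherical_range \<and> pi - arccos c \<le> \<theta>}"
    then obtain r \<phi> \<theta> where "x = spherical r \<phi> \<theta>" "0 \<le> r" "c \<le> - cos \<theta>"
      using iff by (auto simp: spherical_range_def)
    then show "x \<in> {x. norm x * c \<le> x \<bullet> - axis 3 1}"
      using mult_left_mono[of c "- cos \<theta>" r] by (simp add: norm_spherical inner_axis3_spherical)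
  }
qed

subsection \<open>The double-cone solution\<close>

definition profile :: "real \<Rightarrow> real \<Rightarrow> real" where
  "profile s t = - leg (clamp_sym s t) / leg s"

definition profile_deriv :: "real \<Rightarrow> real \<Rightarrow> real" where
  "profile_deriv s t = - leg_deriv (clamp_sym s t) / leg s"

context
  fixes s :: real
  assumes s: "0 < s" "s < 1" "leg_deriv s = 0"
begin

lemma leg_pos: "0 < leg s"
  using leg_strict_mono[OF s, of 0 s] s by (simp add: leg_zero)

lemma leg_minus_s: "leg (- s) = - leg s"
  using s by (intro leg_minus) simp

lemma leg_deriv_minus_s: "leg_deriv (- s) = 0"
  using s leg_deriv_minus[of s] by simp

lemma DERIV_profile: "(profile s has_real_derivative profile_deriv s t) (at t)"
proof -
  have "((\<lambda>t. leg (clamp_sym s t)) has_real_derivative leg_deriv (clamp_sym s t)) (at t)"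
    using s leg_deriv_minus_s by (intro DERIV_clamp_sym DERIV_leg) auto
  then show ?thesis
    unfolding profile_def[abs_def] profile_deriv_def by (intro DERIV_cdivide DERIV_minus)
qed

lemma lipschitz_on_profile_deriv:
  obtains L where "L-lipschitz_on S (profile_deriv s)"
proof -
  obtain L where L: "L-lipschitz_on {-s..s} leg_deriv"
    using lipschitz_on_leg_deriv[OF s(2)] .
  have "1-lipschitz_on S (clamp_sym s)"
    using clamp_sym_dist[of s] by (intro lipschitz_onI) (simp_all add: dist_real_def)
  moreover have "L-lipschitz_on (clamp_sym s ` S) leg_deriv"
    by (rule lipschitz_on_subset[OF L]) (use clamp_sym_bound[of s] s in auto)
  ultimately have "(L * 1)-lipschitz_on S (\<lambda>t. leg_deriv (clamp_sym s t))"
    by (rule lipschitz_on_compose2)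
  from lipschitz_on_cmult_real[OF this, of "- 1 / leg s"]
  show ?thesis by (intro that) (simp add: profile_deriv_def[abs_def])
qed

text \<open>By monotonicity and oddness, \<open>leg\<close> maps [-s, s] into the interval from -
  leg s to leg s.\<close>

lemma profile_bound: "\<bar>profile s t\<bar> \<le> 1"
proof -
  have c: "- s \<le> clamp_sym s t" "clamp_sym s t \<le> s" using clamp_sym_bound[of s t] s by auto
  have "leg (- s) \<le> leg (clamp_sym s t)"
    using leg_strict_mono[OF s, of "- s" "clamp_sym s t"] c by (cases "clamp_sym s t = - s") auto
  moreover have "leg (clamp_sym s t) \<le> leg s"
    using leg_strict_mono[OF s, of "clamp_sym s t" s] c by (cases "clamp_sym s t = s") auto
  ultimately show ?thesis
    using leg_pos leg_minus_s by (simp add: profile_def abs_le_iff field_simps)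
qed

text \<open>By strict monotonicity \<open>leg\<close> attains \<open>leg s\<close> on [-s, s] only
  at s, so there is no contact strictly between the cones. The next lemma is the mirror image at -
  s.\<close>

lemma profile_eq_minus_one_iff: "profile s t = - 1 \<longleftrightarrow> s \<le> t"
proof -
  have c: "- s \<le> clamp_sym s t" "clamp_sym s t \<le> s" using clamp_sym_bound[of s t] s by auto
  have "profile s t = - 1 \<longleftrightarrow> leg (clamp_sym s t) = leg s"
    using leg_pos by (auto simp: profile_def field_simps)
  also have "\<dots> \<longleftrightarrow> clamp_sym s t = s"
    using leg_strict_mono[OF s, of "clamp_sym s t" s] c by (cases "clamp_sym s t = s") auto
  also have "\<dots> \<longleftrightarrow> s \<le> t"
    using s by (auto simp: clamp_sym_def)
  finally show ?thesis .
qed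

lemma profile_eq_one_iff: "profile s t = 1 \<longleftrightarrow> t \<le> - s"
proof -
  have c: "- s \<le> clamp_sym s t" "clamp_sym s t \<le> s" using clamp_sym_bound[of s t] s by auto
  have "profile s t = 1 \<longleftrightarrow> leg (clamp_sym s t) = leg (- s)"
    using leg_pos leg_minus_s by (simp add: profile_def field_simps)
  also have "\<dots> \<longleftrightarrow> clamp_sym s t = - s"
    using leg_strict_mono[OF s, of "- s" "clamp_sym s t"] c by (cases "clamp_sym s t = - s") auto
  also have "\<dots> \<longleftrightarrow> t \<le> - s"
    using s by (auto simp: clamp_sym_def)
  finally show ?thesis .
qed

text \<open>The profile is locally constant here. At |t| = s its derivative has a corner: one
  one-sided derivative is 0, the other is nonzero because \<open>leg_deriv2 s\<close> is negative.
  These values of t form the cone boundaries.\<close>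

lemma DERIV_profile_deriv_outside:
  assumes "s < \<bar>t\<bar>"
  shows "(profile_deriv s has_real_derivative 0) (at t)"
proof (rule has_field_derivative_transform_within_open[OF DERIV_const[of 0]])
  show "open {t. s < \<bar>t\<bar>}" by (intro open_Collect_less continuous_intros)
  show "0 = profile_deriv s y" if "y \<in> {t. s < \<bar>t\<bar>}" for y
  proof -
    have "clamp_sym s y = s \<or> clamp_sym s y = - s" using that s by (auto simp: clamp_sym_def)
    then show ?thesis using s leg_deriv_minus_s by (auto simp: profile_deriv_def)
  qed
qed (use assms in simp)

lemma DERIV_profile_deriv_inside:
  assumes "\<bar>t\<bar> < s"
  shows "(profile_deriv s has_real_derivative - leg_deriv2 t / leg s) (at t)"
proof (rule has_field_derivative_transform_within_open)
  show "((\<lambda>t. - leg_deriv t / leg s) has_real_derivative - leg_deriv2 t / leg s) (at t)"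
    using assms s by (intro DERIV_cdivide DERIV_minus DERIV_leg_deriv) simp
  show "- leg_deriv y / leg s = profile_deriv s y" if "y \<in> {-s<..<s}" for y
    using that by (simp add: profile_deriv_def clamp_sym_def)
qed (use assms in auto)

end

text \<open>Between the cones Legendre's equation makes the Laplacian vanish. Inside them the
  profile is locally constant, and only the term 6 h survives, with h = - 1 or h = 1.\<close>

lemma has_laplacian_zonal_profile:
  fixes e x :: "real ^ 3"
  assumes s: "0 < s" "s < 1" "leg_deriv s = 0" and e: "norm e = 1" and x: "x \<noteq> 0"
    and t: "\<bar>axial e x\<bar> \<noteq> s"
  shows "has_laplacian (zonal (profile s) e)
     (if axial e x > s then - 6 else if axial e x < - s then 6 else 0) x"
proof (cases "\<bar>axial e x\<bar> < s")
  case True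
  let ?t = "axial e x"
  have c: "clamp_sym s ?t = ?t" using True by (simp add: clamp_sym_def abs_less_iff)
  have "(1 - ?t\<^sup>2) * leg_deriv2 ?t - 2 * ?t * leg_deriv ?t + 6 * leg ?t = 0"
    using True s by (intro legendre_equation) simp
  \<comment> \<open>Division by \<open>- leg s\<close> turns Legendre's equation for
    \<open>leg\<close> into the one for the profile; in dimension 3 its coefficients 2 and 6 are the
    dimension minus 1 and twice the dimension.\<close>
  then have "- ((1 - ?t\<^sup>2) * leg_deriv2 ?t - 2 * ?t * leg_deriv ?t + 6 * leg ?t) / leg s = 0"
    by simp
  then have "0 = (1 - ?t\<^sup>2) * (- leg_deriv2 ?t / leg s)
      - (real DIM(real ^ 3) - 1) * ?t * profile_deriv s ?t + 2 * real DIM(real ^ 3) * profile s ?t"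
    using leg_pos[OF s] by (simp add: c profile_def profile_deriv_def field_simps)
  from has_laplacian_zonal[OF e x DERIV_profile[OF s] DERIV_profile_deriv_inside[OF s True] this]
  show ?thesis using True by (simp add: abs_less_iff not_less[symmetric])
next
  case False
  with t have out: "s < \<bar>axial e x\<bar>" by simp
  have d0: "profile_deriv s (axial e x) = 0"
  proof -
    have "clamp_sym s (axial e x) = s \<or> clamp_sym s (axial e x) = - s"
      using out s by (auto simp: clamp_sym_def)
    then show ?thesis using s leg_deriv_minus_s[OF s] by (auto simp: profile_deriv_def)
  qed
  have "profile s (axial e x) = (if axial e x > s then - 1 else 1)"
    using out profile_eq_minus_one_iff[OF s, of "axial e x"] profile_eq_one_iff[OF s, of "axial e x"]
    by auto
  with has_laplacian_zonal[OF e x DERIV_profile[OF s] DERIV_profile_deriv_outside[OF s out] refl] d0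
  show ?thesis using out by (auto split: if_splits)
qed

section \<open>Contact sets and the exceptional null set\<close>

lemma zonal_bound:
  assumes "\<And>t. \<bar>h t\<bar> \<le> 1"
  shows "\<bar>zonal h e x\<bar> \<le> (norm x)\<^sup>2"
  using mult_left_mono[OF assms, of "(norm x)\<^sup>2"] by (simp add: zonal_def abs_mult)

lemma zonal_eq_scaled_norm_squared_iff:
  "zonal h e x = c * (norm x)\<^sup>2 \<longleftrightarrow> x = 0 \<or> h (axial e x) = c"
  by (auto simp: zonal_def)

text \<open>At the origin all these relations hold, so the vertex lies in both contact sets.
  Elsewhere the inequalities are those for the profile, multiplied by |x|.\<close>

lemma zonal_profile_contact:
  assumes s: "0 < s" "s < 1" "leg_deriv s = 0"
  shows "zonal (profile s) e x = - 1 * (norm x)\<^sup>2 \<longleftrightarrow> norm x * s \<le> x \<bullet> e"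
    and "zonal (profile s) e x = 1 * (norm x)\<^sup>2 \<longleftrightarrow> norm x * s \<le> x \<bullet> - e"
  unfolding zonal_eq_scaled_norm_squared_iff profile_eq_minus_one_iff[OF s] profile_eq_one_iff[OF s]
  by (cases "x = 0"; auto simp: axial_def pos_le_divide_eq pos_divide_le_eq mult.commute)+

text \<open>The half-opening angle is \<open>arccos s\<close>; the bounds 0 < s < 1 place it
  strictly between 0 and pi / 2.\<close>

lemma halfcone_circular:
  assumes "norm e = 1" "0 < s" "s < 1"
  shows "halfcone 0 {x. norm x * s \<le> x \<bullet> e}"
  unfolding halfcone_def
proof (intro exI conjI)
  show "0 < arccos s" using assms arccos_less_arccos[of s 1] by simp
  show "arccos s < pi / 2" using assms arccos_less_arccos[of 0 s] by simp
  show "{x. norm x * s \<le> x \<bullet> e} = {x. norm (x - 0) * cos (arccos s) \<le> (x - 0) \<bullet> e}"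
    using assms by (simp add: cos_arccos)
qed (rule assms)

text \<open>The indicators belong to closed cones, while the pointwise Laplacian is known on the
  open regions. The two descriptions agree off the two cone surfaces, which are null sets and
  contain the origin.\<close>

lemma AE_has_laplacian_zonal_profile:
  fixes e :: "real ^ 3"
  assumes s: "0 < s" "s < 1" "leg_deriv s = 0" and e: "norm e = 1"
  shows "AE x in lebesgue. has_laplacian (zonal (profile s) e)
     (- 6 * indicator {y. norm y * s \<le> y \<bullet> e} x + 6 * indicator {y. norm y * s \<le> y \<bullet> - e} x) x"
proof -
  let ?N = "{x. x \<bullet> e = s * norm x} \<union> {x. x \<bullet> - e = s * norm x}"
  have "negligible ?N"
    using s e by (intro negligible_Un negligible_cone_boundary) auto
  then have "AE x in lebesgue. x \<notin> ?N"
    by (intro AE_not_in) (simp add: negligible_iff_null_sets)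
  then show ?thesis
  proof eventually_elim
    case (elim x)
    then have x: "x \<noteq> 0" by auto
    let ?t = "axial e x"
    have xe: "x \<bullet> e = ?t * norm x" using x by (simp add: axial_def)
    have "?t \<noteq> s" "?t \<noteq> - s" using elim by (auto simp: xe)
    then have "\<bar>?t\<bar> \<noteq> s" by linarith
    note lap = has_laplacian_zonal_profile[OF s e x this]
    have "norm x * s \<le> x \<bullet> e \<longleftrightarrow> s \<le> ?t" "norm x * s \<le> x \<bullet> - e \<longleftrightarrow> ?t \<le> - s"
      using x by (auto simp: axial_def pos_le_divide_eq pos_divide_le_eq mult.commute)
    then have "- 6 * indicator {y. norm y * s \<le> y \<bullet> e} x + 6 * indicator {y. norm y * s \<le> y \<bullet> - e} x
        = (if ?t > s then - 6 else if ?t < - s then 6 else (0::real))"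
      using \<open>?t \<noteq> s\<close> \<open>?t \<noteq> - s\<close> s by (simp add: indicator_def)
    with lap show ?case by simp
  qed
qed

text \<open>The function \<open>q\<close> is prescribed only for 0 < \<theta> < pi, where cos
  \<theta> lies in the domain of \<open>g\<close>, and \<open>u\<close> takes its values from
  \<open>q\<close> only there. On the common boundary angles the formulas agree: \<open>q\<close>
  equals \<open>p1\<close> at \<open>arccos t0\<close> and \<open>p2\<close> at pi -
  \<open>arccos t0\<close>, so the contact sets are the closed cones.\<close>

theorem mainTheorem11:
  fixes p1 p2 q u :: "real ^ 3 \<Rightarrow> real" and g :: "real \<Rightarrow> real" and t0 :: real
  assumes p1: "\<And>r \<phi> \<theta>. (r, \<phi>, \<theta>) \<in> spherical_range \<Longrightarrow> p1 (spherical r \<phi> \<theta>) = - (r\<^sup>2)"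
    and p2: "\<And>r \<phi> \<theta>. (r, \<phi>, \<theta>) \<in> spherical_range \<Longrightarrow> p2 (spherical r \<phi> \<theta>) = r\<^sup>2"
    and g: "\<And>t. - 1 < t \<Longrightarrow> t < 1 \<Longrightarrow> g t = 3 * t + (3 * t\<^sup>2 - 1) / 2 * ln ((1 - t) / (1 + t))"
    and t0: "0 < t0" "t0 < 1" "(g has_real_derivative 0) (at t0)"
    and q: "\<And>r \<phi> \<theta>. (r, \<phi>, \<theta>) \<in> spherical_range \<Longrightarrow> 0 < \<theta> \<Longrightarrow> \<theta> < pi \<Longrightarrow>
              q (spherical r \<phi> \<theta>) = - (r\<^sup>2 * g (cos \<theta>) / g t0)"
    and u: "\<And>r \<phi> \<theta>. (r, \<phi>, \<theta>) \<in> spherical_range \<Longrightarrow>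
              u (spherical r \<phi> \<theta>) =
                (if \<theta> \<le> arccos t0 then p1 (spherical r \<phi> \<theta>)
                 else if \<theta> \<le> pi - arccos t0 then q (spherical r \<phi> \<theta>)
                 else p2 (spherical r \<phi> \<theta>))"
  shows "double_cone_solution p1 p2 (- 6) 6 u \<and>
         {x. u x = p1 x} =
           {spherical r \<phi> \<theta> | r \<phi> \<theta>. (r, \<phi>, \<theta>) \<in> spherical_range \<and> \<theta> \<le> arccos t0} \<and>
         {x. u x = p2 x} =
           {spherical r \<phi> \<theta> | r \<phi> \<theta>. (r, \<phi>, \<theta>) \<in> spherical_range \<and> pi - arccos t0 \<le> \<theta>}"
proof -
  define e :: "real ^ 3" where "e = axis 3 1"
  have e: "norm e = 1" "norm (- e) = 1" by (simp_all add: e_def)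
  have gleg: "g t = leg t" if "- 1 < t" "t < 1" for t
    using g[OF that] by (simp add: leg_def)
  \<comment> \<open>\<open>g\<close> agrees with \<open>leg\<close> on an open interval around
    \<open>t0\<close>, so the vanishing derivative carries over, and uniqueness of derivatives gives
    a zero of \<open>leg_deriv\<close>.\<close>
  have "(leg has_real_derivative 0) (at t0)"
    by (rule has_field_derivative_transform_within_open[OF t0(3), of "{-1<..<1}"])
      (use t0 gleg in auto)
  moreover have "(leg has_real_derivative leg_deriv t0) (at t0)"
    using t0 by (intro DERIV_leg) simp
  ultimately have "leg_deriv t0 = 0" by (rule DERIV_unique[symmetric])
  with t0 have s: "0 < t0" "t0 < 1" "leg_deriv t0 = 0" by auto
  \<comment> \<open>This keeps the middle region away from the poles, so that the formula for
    \<open>q\<close> applies throughout it.\<close>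
  have acos: "0 < arccos t0" using s arccos_less_arccos[of t0 1] by simp

  have p1': "p1 = (\<lambda>x. - 1 * (norm x)\<^sup>2)" and p2': "p2 = (\<lambda>x. 1 * (norm x)\<^sup>2)"
  proof -
    show "p1 = (\<lambda>x. - 1 * (norm x)\<^sup>2)"
    proof
      fix x
      obtain r \<phi> \<theta> where "(r, \<phi>, \<theta>) \<in> spherical_range" "x = spherical r \<phi> \<theta>"
        by (rule spherical_surj)
      then show "p1 x = - 1 * (norm x)\<^sup>2"
        using p1 by (simp add: norm_spherical spherical_range_def)
    qed
    show "p2 = (\<lambda>x. 1 * (norm x)\<^sup>2)"
    proof
      fix x
      obtain r \<phi> \<theta> where "(r, \<phi>, \<theta>) \<in> spherical_range" "x = spherical r \<phi> \<theta>"
        by (rule spherical_surj)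
      then show "p2 x = 1 * (norm x)\<^sup>2"
        using p2 by (simp add: norm_spherical spherical_range_def)
    qed
  qed
  have u': "u = zonal (profile t0) e"
  proof
    fix x
    obtain r \<phi> \<theta> where x: "(r, \<phi>, \<theta>) \<in> spherical_range" "x = spherical r \<phi> \<theta>"
      by (rule spherical_surj)
    then have r: "0 \<le> r" and \<theta>: "0 \<le> \<theta>" "\<theta> \<le> pi" by (auto simp: spherical_range_def)
    \<comment> \<open>For r = 0 the value \<open>axial e x\<close> is 0 and need not be cos
      \<theta>, but the factor r^2 makes both sides 0.\<close>
    have z: "zonal (profile t0) e x = r\<^sup>2 * profile t0 (cos \<theta>)"
      using r by (cases "r = 0")
        (simp_all add: zonal_def axial_def e_def x(2) norm_spherical inner_axis3_spherical)
    have north: "\<theta> \<le> arccos t0 \<longleftrightarrow> t0 \<le> cos \<theta>"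
      using \<theta> s by (intro le_arccos_iff) auto
    have south: "pi - arccos t0 \<le> \<theta> \<longleftrightarrow> cos \<theta> \<le> - t0"
      using \<theta> s le_arccos_iff[of "pi - \<theta>" t0] by auto
    consider "\<theta> \<le> arccos t0" | "arccos t0 < \<theta>" "\<theta> \<le> pi - arccos t0" | "arccos t0 < \<theta>" "pi - arccos t0 < \<theta>"
      by linarith
    then show "u x = zonal (profile t0) e x"
    proof cases
      case 1
      then have "profile t0 (cos \<theta>) = - 1"
        unfolding profile_eq_minus_one_iff[OF s] using north by simp
      then show ?thesis using 1 u[OF x(1)] p1[OF x(1)] z x(2) by simp
    next
      case 2
      then have "u x = - (r\<^sup>2 * g (cos \<theta>) / g t0)"
        using u[OF x(1)] q[OF x(1)] acos x(2) by simp
      \<comment> \<open>The bounds put cos \<theta> in [-t0, t0], where the truncation is the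
        identity. The lower bound is attained at \<theta> = pi - \<open>arccos t0\<close>, which
        belongs to this case.\<close>
      moreover have c: "- t0 \<le> cos \<theta>" "cos \<theta> \<le> t0"
        using cos_monotone_0_pi_le[OF \<theta>(1) 2(2)] 2(1) north s acos by (simp_all add: cos_arccos)
      have "g (cos \<theta>) = leg (cos \<theta>)" "g t0 = leg t0"
        using c s by (intro gleg; linarith)+
      moreover have "clamp_sym t0 (cos \<theta>) = cos \<theta>"
        using c by (simp add: clamp_sym_def)
      ultimately show ?thesis by (simp add: z profile_def)
    next
      case 3
      then have "profile t0 (cos \<theta>) = 1"
        unfolding profile_eq_one_iff[OF s] using south by simp
      then show ?thesis using 3 u[OF x(1)] p2[OF x(1)] z x(2) by simp
    qed
  qed

  have contact1: "{x. u x = p1 x} = {x. norm x * t0 \<le> x \<bullet> e}"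
    unfolding u' p1' zonal_profile_contact[OF s] ..
  have contact2: "{x. u x = p2 x} = {x. norm x * t0 \<le> x \<bullet> - e}"
    unfolding u' p2' zonal_profile_contact[OF s] ..
  have "C11_loc u"
  proof -
    obtain L where "L-lipschitz_on {-1..1} (profile_deriv t0)"
      by (rule lipschitz_on_profile_deriv[OF s])
    then show ?thesis unfolding u' by (rule C11_loc_zonal[OF e(1) DERIV_profile[OF s]])
  qed
  moreover have "p1 x \<le> u x \<and> u x \<le> p2 x" for x
    using zonal_bound[where h = "profile t0" and e = e and x = x, OF profile_bound[OF s]]
    unfolding p1' p2' u' by (simp add: abs_le_iff)
  moreover have "has_laplacian p1 (- 6) x" "has_laplacian p2 6 x" for x
    using has_laplacian_scaled_norm_squared[of "- 1" x] has_laplacian_scaled_norm_squared[of 1 x]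
    unfolding p1' p2' by simp_all
  moreover have "AE x in lebesgue. has_laplacian u
      (- 6 * indicator {y. u y = p1 y} x + 6 * indicator {y. u y = p2 y} x) x"
    unfolding contact1 contact2 unfolding u' by (rule AE_has_laplacian_zonal_profile[OF s e(1)])
  ultimately have "double_obstacle_solution p1 p2 (- 6) 6 u"
    unfolding double_obstacle_solution_def by (auto intro: order_trans)
  moreover have "halfcone 0 {x. u x = p1 x}" "halfcone 0 {x. u x = p2 x}"
    unfolding contact1 contact2 by (intro halfcone_circular e s)+
  ultimately have "double_cone_solution p1 p2 (- 6) 6 u"
    unfolding double_cone_solution_def by blast
  then show ?thesis
    unfolding contact1 contact2 e_def
    using s by (simp add: circular_cone_spherical opposite_circular_cone_spherical
        del: inner_minus_right)
qed

end
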